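(* Let $Q \subset \mathbb{R}^M$ be a measurable set with $|Q|<\infty$, and let $\{U_n\}_{n=1}^\infty$, $\{V_n\}_{n=1}^\infty$ be two statistically equivalent sequences of measurable functions $Q \to \mathbb{R}^D$. Suppose that $U_n \stackrel{(S)}{\to} \mathcal V$, i.e. $\{U_n\}$ is weakly (S)-convergent with (S)-limit $\mathcal V$. Then $V_n \stackrel{(S)}{\to} \mathcal V$, i.e. $\{V_n\}$ is weakly (S)-convergent with the same (S)-limit $\mathcal V$.
   Context: Statistical equivalence: $\{U_n\}$ and $\{V_n\}$ are statistically equivalent if for every $\varepsilon>0$ $$\frac{\#\{ n \le N : \int_Q |U_n - V_n|\,dy > \varepsilon\}}{N} \to 0 \quad\text{as } N\to\infty.$$ Weak (S)-convergence: $\{U_n\}$ is weakly (S)-convergent if for every $b \in C_c(\mathbb{R}^D)$: (a) for every fixed $m$ the limit $\lim_{N\to\infty} \frac1N \sum_{n=1}^N \int_Q b(U_n) b(U_m)\,dy$ exists; and (b) the following limits exist and $$\lim_{N\to\infty} \frac1{N^2}\sum_{n,m=1}^N \int_Q b(U_n)b(U_m)\,dy = \lim_{M\to\infty} \frac1M \sum_{m=1}^M \Big[ \lim_{N\to\infty} \frac1N \sum_{n=1}^N \int_Q b(U_n) b(U_m)\,dy \Big].$$ (S)-limit: for a weakly (S)-convergent sequence, $\frac1N\sum_{n=1}^N b(U_n)$ converges weakly-( * ) in $L^\infty(Q)$ to a limit denoted $\overline{b(U)}$ for each $b \in C_c(\mathbb{R}^D)$. The (S)-limit is the unique parametrized measure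 $\mathcal V = (\mathcal V_y)_{y\in Q} \in L^\infty_{\text{weak-( * )}}(Q;\mathcal M^+(\mathbb{R}^D))$ (the space $L^\infty_{\text{weak-( * )}}(Q;\mathcal M(\mathbb{R}^D))$ being identified with the dual of $L^1(Q; C_0(\mathbb{R}^D))$) such that $\int_Q \varphi(y) \int_{\mathbb{R}^D} b\, d\mathcal V_y\, dy = \int_Q \varphi\, \overline{b(U)}\,dy$ for all $\varphi\in L^1(Q)$, $b \in C_c(\mathbb{R}^D)$. One writes $U_n \stackrel{(S)}{\to}\mathcal V$. *)

theory Defs
  imports "HOL-Analysis.Analysis"
begin

text \<open>Sequences \<open>U_1, U_2, \<dots>\<close> of maps \<open>Q \<rightarrow> \<real>\<^sup>D\<close> are functions on all of \<^typ>\<open>nat\<close> and on the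
  whole space; their values at index \<open>0\<close> and outside \<open>Q\<close> play no role. Test functions are
  real valued.\<close>

definition C_c :: "('a::euclidean_space \<Rightarrow> real) set" where
  "C_c = {b. continuous_on UNIV b \<and> compact (closure {x. b x \<noteq> 0})}"

definition C_0 :: "('a::euclidean_space \<Rightarrow> real) set" where
  "C_0 = {b. continuous_on UNIV b \<and> (b \<longlongrightarrow> 0) at_infinity}"

definition L_infty :: "'a::euclidean_space set \<Rightarrow> ('a \<Rightarrow> real) set" where
  "L_infty Q = {g. g \<in> borel_measurable (lebesgue_on Q) \<and>
     (\<exists>C. AE y in lebesgue_on Q. \<bar>g y\<bar> \<le> C)}"

definition weak_star_tendsto ::
    "'a::euclidean_space set \<Rightarrow> (nat \<Rightarrow> 'a \<Rightarrow> real) \<Rightarrow> ('a \<Rightarrow> real) \<Rightarrow> bool" where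
  "weak_star_tendsto Q f g \<longleftrightarrow>
     (\<forall>N\<ge>1. f N \<in> L_infty Q) \<and> g \<in> L_infty Q \<and>
     (\<forall>\<phi>. integrable (lebesgue_on Q) \<phi> \<longrightarrow>
        (\<lambda>N. LINT y|lebesgue_on Q. \<phi> y * f N y) \<longlonglongrightarrow> (LINT y|lebesgue_on Q. \<phi> y * g y))"

text \<open>The integral below is taken in \<open>[0,\<infinity>]\<close>: the functions are only measurable, so
  \<open>U n - V n\<close> need not be integrable, and such an \<open>n\<close> has to be counted.\<close>

definition statistically_equivalent ::
    "'a::euclidean_space set \<Rightarrow> (nat \<Rightarrow> 'a \<Rightarrow> 'b::euclidean_space) \<Rightarrow> (nat \<Rightarrow> 'a \<Rightarrow> 'b) \<Rightarrow> bool" where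
  "statistically_equivalent Q U V \<longleftrightarrow>
     (\<forall>\<epsilon>>0. (\<lambda>N. real (card {n \<in> {1..N}.
          (\<integral>\<^sup>+ y. ennreal (norm (U n y - V n y)) \<partial>lebesgue_on Q) > ennreal \<epsilon>}) / real N) \<longlonglongrightarrow> 0)"

definition corr ::
    "'a::euclidean_space set \<Rightarrow> (nat \<Rightarrow> 'a \<Rightarrow> 'b::euclidean_space) \<Rightarrow> ('b \<Rightarrow> real) \<Rightarrow> nat \<Rightarrow> nat \<Rightarrow> real" where
  "corr Q U b n m = (LINT y|lebesgue_on Q. b (U n y) * b (U m y))"

definition weakly_S_convergent ::
    "'a::euclidean_space set \<Rightarrow> (nat \<Rightarrow> 'a \<Rightarrow> 'b::euclidean_space) \<Rightarrow> bool" where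
  "weakly_S_convergent Q U \<longleftrightarrow> (\<forall>b\<in>C_c.
     (\<forall>m\<ge>1. convergent (\<lambda>N. (1 / real N) * (\<Sum>n=1..N. corr Q U b n m))) \<and>
     (\<exists>L. (\<lambda>N. (1 / (real N)\<^sup>2) * (\<Sum>n=1..N. \<Sum>m=1..N. corr Q U b n m)) \<longlonglongrightarrow> L \<and>
          (\<lambda>M. (1 / real M) * (\<Sum>m=1..M.
              lim (\<lambda>N. (1 / real N) * (\<Sum>n=1..N. corr Q U b n m)))) \<longlonglongrightarrow> L))"

text \<open>Representatives of elements of \<open>L\<^sup>\<infinity>\<close>-weak-(*) of \<open>Q\<close> with values in the positive finite
  Borel (equivalently, Radon) measures on the Euclidean space \<^typ>\<open>'b\<close>; the total variation norm of
  a positive measure is its total mass.\<close>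

definition parametrized_measure ::
    "'a::euclidean_space set \<Rightarrow> ('a \<Rightarrow> 'b::euclidean_space measure) \<Rightarrow> bool" where
  "parametrized_measure Q \<V> \<longleftrightarrow>
     (\<forall>y\<in>Q. finite_measure (\<V> y) \<and> sets (\<V> y) = sets borel) \<and>
     (\<forall>b\<in>C_0. (\<lambda>y. LINT x|\<V> y. b x) \<in> borel_measurable (lebesgue_on Q)) \<and>
     (\<exists>C. AE y in lebesgue_on Q. measure (\<V> y) UNIV \<le> C)"

text \<open>The limit is determined only up to equality for almost every \<open>y \<in> Q\<close>, so ``\<open>\<V>\<close> is the
  (S)-limit of \<open>U\<close>'' is a relation between \<open>U\<close> and representatives \<open>\<V>\<close>. The function \<open>bU\<close> is the
  weak-(*) limit written as \<open>b(U)\<close> with a bar.\<close>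

definition S_limit ::
    "'a::euclidean_space set \<Rightarrow> (nat \<Rightarrow> 'a \<Rightarrow> 'b::euclidean_space) \<Rightarrow> ('a \<Rightarrow> 'b measure) \<Rightarrow> bool" where
  "S_limit Q U \<V> \<longleftrightarrow>
     weakly_S_convergent Q U \<and> parametrized_measure Q \<V> \<and>
     (\<forall>b\<in>C_c. \<exists>bU.
        weak_star_tendsto Q (\<lambda>N y. (1 / real N) * (\<Sum>n=1..N. b (U n y))) bU \<and>
        (\<forall>\<phi>. integrable (lebesgue_on Q) \<phi> \<longrightarrow>
           (LINT y|lebesgue_on Q. \<phi> y * (LINT x|\<V> y. b x)) = (LINT y|lebesgue_on Q. \<phi> y * bU y)))"

end

theory Submission
  imports Defs
begin

text \<open>Let \<open>A\<^sub>N\<close> and \<open>B\<^sub>N\<close> be the Cesaro means of \<open>b(U\<^sub>n)\<close> and \<open>b(V\<^sub>n)\<close>. A test function \<open>b\<close>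
  satisfies \<open>\<bar>b x - b y\<bar> \<le> \<eta> + K \<bar>x - y\<bar>\<close> for every \<open>\<eta> > 0\<close> and suitable \<open>K\<close>, so statistical
  equivalence makes \<open>\<integral> \<bar>b(U\<^sub>n) - b(V\<^sub>n)\<bar>\<close> small outside a set of density zero, and
  \<open>A\<^sub>N - B\<^sub>N \<rightarrow> 0\<close> in \<open>L\<^sup>1\<close>. Since the means are uniformly bounded, they have the same weak-(*)
  limit \<open>g\<close>. Testing with \<open>b(V\<^sub>m)\<close> and then with \<open>g\<close> gives condition (a) and identifies the
  iterated limit in (b) as \<open>\<integral> g\<^sup>2\<close>, for both sequences. The double mean is \<open>\<integral> A\<^sub>N\<^sup>2\<close>, and
  \<open>\<integral> B\<^sub>N\<^sup>2 - \<integral> A\<^sub>N\<^sup>2 \<rightarrow> 0\<close> by the \<open>L\<^sup>1\<close> convergence.\<close>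

section \<open>Cesaro means of real sequences\<close>

text \<open>As an abbreviation it matches the averages written out in
  \<open>weakly_S_convergent\<close> and \<open>S_limit\<close> without any unfolding.\<close>

abbreviation cesaro :: "(nat \<Rightarrow> real) \<Rightarrow> nat \<Rightarrow> real" where
  "cesaro x N \<equiv> (1 / real N) * (\<Sum>n=1..N. x n)"

lemma abs_cesaro_le:
  assumes "\<And>n. n \<ge> 1 \<Longrightarrow> \<bar>x n\<bar> \<le> B" and "0 \<le> B"
  shows "\<bar>cesaro x N\<bar> \<le> B"
\<comment> \<open>For \<open>N = 0\<close> the mean is 0 because \<open>1 / 0 = 0\<close>; the
  assumption \<open>0 \<le> B\<close> settles this case.\<close>
proof (cases "N = 0")
  case False
  have "\<bar>\<Sum>n=1..N. x n\<bar> \<le> (\<Sum>n=1..N. \<bar>x n\<bar>)" by (rule sum_abs)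
  also have "\<dots> \<le> (\<Sum>n=1..N. B)" by (rule sum_mono) (use assms in auto)
  finally show ?thesis using False by (simp add: abs_mult field_simps)
qed (use assms in simp)

text \<open>Indices with \<open>d n > r/2\<close> contribute at most \<open>C\<close> times their
  density in \<open>{1..N}\<close>, which tends to 0; all others together contribute at most
  \<open>r/2\<close>.\<close>

lemma cesaro_tendsto_0:
  fixes d :: "nat \<Rightarrow> real"
  assumes bnd: "\<And>n. n \<ge> 1 \<Longrightarrow> d n \<le> C" and nn: "\<And>n. d n \<ge> 0" and "C \<ge> 0"
    and dens: "\<And>\<eta>. \<eta> > 0 \<Longrightarrow> (\<lambda>N. real (card {n \<in> {1..N}. d n > \<eta>}) / real N) \<longlonglongrightarrow> 0"
  shows "cesaro d \<longlonglongrightarrow> 0"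
proof (rule LIMSEQ_I)
  fix r :: real assume r: "r > 0"
  define E where "E N = {n \<in> {1..N}. d n > r/2}" for N
  have "(\<lambda>N. C * (real (card (E N)) / real N)) \<longlonglongrightarrow> C * 0"
    unfolding E_def by (intro tendsto_mult_left dens) (use r in simp)
  then have "\<forall>\<^sub>F N in sequentially. C * (real (card (E N)) / real N) < r/2"
    by (rule order_tendstoD) (use r in simp)
  then obtain N0 where N0: "\<And>N. N \<ge> N0 \<Longrightarrow> C * (real (card (E N)) / real N) < r/2"
    unfolding eventually_sequentially by blast
  have "norm (cesaro d N - 0) < r" if N: "N \<ge> max 1 N0" for N
  proof -
    have "(\<Sum>n=1..N. d n) \<le> (\<Sum>n=1..N. r/2 + (if n \<in> E N then C else 0))"
    proof (rule sum_mono)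
      fix n assume n: "n \<in> {1..N}"
      have "d n \<le> C" using n bnd by auto
      then show "d n \<le> r/2 + (if n \<in> E N then C else 0)"
        using n r by (auto simp: E_def)
    qed
    also have "\<dots> = real N * (r/2) + C * real (card (E N))"
    proof -
      have "{1..N} \<inter> E N = E N" by (auto simp: E_def)
      then show ?thesis by (simp add: sum.distrib sum.If_cases)
    qed
    finally have "cesaro d N \<le> r/2 + C * (real (card (E N)) / real N)"
      using N by (simp add: field_simps)
    also have "\<dots> < r / 2 + r / 2" using N0[of N] N by (intro add_strict_left_mono) simp
    finally have "cesaro d N < r" by simp
    then show ?thesis by (simp add: sum_nonneg nn)
  qed
  then show "\<exists>no. \<forall>n\<ge>no. norm (cesaro d n - 0) < r" by blast
qed

section \<open>Compactly supported test functions\<close>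

lemma C_c_bounded:
  assumes "b \<in> C_c"
  obtains B where "B > 0" "\<And>x. \<bar>b x\<bar> \<le> B"
proof -
  let ?S = "closure {x. b x \<noteq> 0}"
  have "bounded (b ` ?S)"
    using assms by (intro compact_imp_bounded compact_continuous_image)
      (auto simp: C_c_def intro: continuous_on_subset)
  then obtain B where B: "B > 0" "\<And>x. x \<in> ?S \<Longrightarrow> \<bar>b x\<bar> \<le> B"
    unfolding bounded_pos by auto
  have "\<bar>b x\<bar> \<le> B" for x
    using B closure_subset[of "{x. b x \<noteq> 0}"] by (cases "b x = 0") auto
  with B show ?thesis using that by blast
qed

text \<open>Heine-Cantor applies on the ball of radius \<open>R + 1\<close>, where the support lies
  in the ball of radius \<open>R\<close>. Two points at distance below 1 are either both outside the
  smaller ball, where \<open>b\<close> vanishes, or both inside the larger one.\<close>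

lemma C_c_uniformly_continuous:
  assumes "b \<in> C_c"
  shows "uniformly_continuous_on UNIV b"
proof -
  have cont: "continuous_on UNIV b" and comp: "compact (closure {x. b x \<noteq> 0})"
    using assms by (auto simp: C_c_def)
  obtain R where R: "\<And>x. x \<in> closure {x. b x \<noteq> 0} \<Longrightarrow> norm x \<le> R"
    using compact_imp_bounded[OF comp] unfolding bounded_iff by blast
  have zero: "b x = 0" if "norm x > R" for x
    using R[of x] closure_subset[of "{x. b x \<noteq> 0}"] that by force
  have uc: "uniformly_continuous_on (cball 0 (R + 1)) b"
    by (intro compact_uniformly_continuous continuous_on_subset[OF cont]) auto
  show ?thesis
    unfolding uniformly_continuous_on_def
  proof (intro allI impI)
    fix e :: real assume e: "e > 0"
    obtain \<delta> where \<delta>: "\<delta> > 0"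
      "\<And>x y. x \<in> cball 0 (R + 1) \<Longrightarrow> y \<in> cball 0 (R + 1) \<Longrightarrow> dist y x < \<delta> \<Longrightarrow> dist (b y) (b x) < e"
      using uc e unfolding uniformly_continuous_on_def by metis
    have "dist (b y) (b x) < e" if "dist y x < min \<delta> 1" for x y
    proof (cases "norm x > R \<and> norm y > R")
      case True
      then show ?thesis using zero e by simp
    next
      case False
      have "norm (y - x) < 1" using that by (simp add: dist_norm)
      then have "norm x \<le> R + 1" "norm y \<le> R + 1"
        using False norm_triangle_ineq3[of y x] by auto
      then show ?thesis using \<delta>(2)[of x y] that by simp
    qed
    then show "\<exists>d>0. \<forall>x\<in>UNIV. \<forall>x'\<in>UNIV. dist x' x < d \<longrightarrow> dist (b x') (b x) < e"
      using \<delta>(1) by (intro exI[of _ "min \<delta> 1"]) auto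
  qed
qed

text \<open>Points closer than \<open>\<delta>\<close> are handled by uniform continuity. For all
  others the oscillation is at most \<open>2 * B\<close>, and
  \<open>norm (x - y) / \<delta> \<ge> 1\<close>. Unlike a modulus of continuity, an affine bound in
  \<open>norm (x - y)\<close> can be integrated directly.\<close>

lemma C_c_almost_Lipschitz:
  assumes "b \<in> C_c" and "\<eta> > 0"
  obtains K where "K > 0" "\<And>x y. \<bar>b x - b y\<bar> \<le> \<eta> + K * norm (x - y)"
proof -
  obtain B where B: "B > 0" "\<And>x. \<bar>b x\<bar> \<le> B" using C_c_bounded[OF assms(1)] by blast
  obtain \<delta> where \<delta>: "\<delta> > 0" "\<And>x y. dist x y < \<delta> \<Longrightarrow> dist (b x) (b y) < \<eta>"
    using C_c_uniformly_continuous[OF assms(1)] assms(2)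
    unfolding uniformly_continuous_on_def by (metis UNIV_I)
  have "\<bar>b x - b y\<bar> \<le> \<eta> + (2 * B / \<delta>) * norm (x - y)" for x y
  proof (cases "norm (x - y) < \<delta>")
    case True
    then have "\<bar>b x - b y\<bar> < \<eta>" using \<delta>(2)[of x y] by (simp add: dist_norm)
    moreover have "0 \<le> (2 * B / \<delta>) * norm (x - y)" using B \<delta> by simp
    ultimately show ?thesis by linarith
  next
    case False
    have "\<bar>b x - b y\<bar> \<le> 2 * B" using B(2)[of x] B(2)[of y] by linarith
    also have "\<dots> = (2 * B / \<delta>) * \<delta>" using \<delta> by simp
    also have "\<dots> \<le> (2 * B / \<delta>) * norm (x - y)"
      using False B \<delta> by (intro mult_left_mono) auto
    finally show ?thesis using assms(2) by linarith
  qed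
  then show ?thesis using that[of "2 * B / \<delta>"] B \<delta> by simp
qed

lemma C_c_borel_measurable: "b \<in> C_c \<Longrightarrow> b \<in> borel_measurable borel"
  by (auto simp: C_c_def intro: borel_measurable_continuous_onI)

section \<open>Estimates on a finite measure space\<close>

lemma (in finite_measure) integrable_bounded:
  fixes f :: "'a \<Rightarrow> real"
  assumes "f \<in> borel_measurable M" and "\<And>x. \<bar>f x\<bar> \<le> B"
  shows "integrable M f"
  by (rule integrable_const_bound[of _ B]) (use assms in auto)

lemma (in finite_measure) L1_diff_le:
  fixes u v :: "'a \<Rightarrow> 'b::euclidean_space"
  assumes [measurable]: "u \<in> borel_measurable M" "v \<in> borel_measurable M" "b \<in> borel_measurable borel"
    and lip: "\<And>x y. \<bar>b x - b y\<bar> \<le> \<eta> + K * norm (x - y)" and K: "K \<ge> 0"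
    and bnd: "\<And>x. \<bar>b x\<bar> \<le> B"
    and uv: "(\<integral>\<^sup>+ y. ennreal (norm (u y - v y)) \<partial>M) \<le> ennreal \<epsilon>" and \<epsilon>: "\<epsilon> \<ge> 0"
  shows "(LINT y|M. \<bar>b (u y) - b (v y)\<bar>) \<le> \<eta> * measure M (space M) + K * \<epsilon>"
proof -
  \<comment> \<open>Finiteness of the extended integral gives integrability, so that the real
    integral below is the true value and not the default 0.\<close>
  have int: "integrable M (\<lambda>y. norm (u y - v y))"
    using uv by (intro integrableI_bounded) (auto simp: le_less_trans)
  have le: "(LINT y|M. norm (u y - v y)) \<le> \<epsilon>"
    using uv \<epsilon> by (simp add: nn_integral_eq_integral[OF int])
  have "(LINT y|M. \<bar>b (u y) - b (v y)\<bar>) \<le> (LINT y|M. \<eta> + K * norm (u y - v y))"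
  proof (rule integral_mono)
    have "\<bar>b (u y) - b (v y)\<bar> \<le> 2 * B" for y using bnd[of "u y"] bnd[of "v y"] by linarith
    then show "integrable M (\<lambda>y. \<bar>b (u y) - b (v y)\<bar>)"
      by (intro integrable_bounded[of _ "2 * B"]) auto
  qed (use int lip in auto)
  also have "\<dots> = \<eta> * measure M (space M) + K * (LINT y|M. norm (u y - v y))"
    using int by simp
  also have "\<dots> \<le> \<eta> * measure M (space M) + K * \<epsilon>" using le K by (simp add: mult_left_mono)
  finally show ?thesis .
qed

text \<open>Truncation: \<open>\<bar>\<phi>\<bar>\<close> is at most a constant \<open>k\<close>
  plus a tail that is small in L1. The constant part is controlled by the L1 convergence of
  \<open>g N\<close>, the tail by the uniform bound \<open>B\<close>. This is how L1 convergence of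
  bounded functions is tested against an arbitrary integrable \<open>\<phi>\<close>.\<close>

lemma (in finite_measure) tendsto_integral_mult_0:
  fixes \<phi> :: "'a \<Rightarrow> real"
  assumes \<phi>: "integrable M \<phi>"
    and [measurable]: "\<And>N. g N \<in> borel_measurable M"
    and bnd: "\<And>N y. \<bar>g N y\<bar> \<le> B" and B: "B > 0"
    and L1: "(\<lambda>N::nat. LINT y|M. \<bar>g N y\<bar>) \<longlonglongrightarrow> 0"
  shows "(\<lambda>N. LINT y|M. \<phi> y * g N y) \<longlonglongrightarrow> 0"
proof (rule LIMSEQ_I)
  fix r :: real assume r: "r > 0"
  have [measurable]: "\<phi> \<in> borel_measurable M" using \<phi> by simp
  let ?tail = "\<lambda>k::nat. \<lambda>y. max (\<bar>\<phi> y\<bar> - real k) 0"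
  have int_tail: "integrable M (?tail k)" for k
    by (rule Bochner_Integration.integrable_bound[OF \<phi>]) auto
  \<comment> \<open>At each point the tail vanishes once \<open>k\<close> exceeds
    \<open>\<bar>\<phi> y\<bar>\<close>, and it is dominated by
    \<open>\<bar>\<phi>\<bar>\<close>.\<close>
  have "(\<lambda>k. LINT y|M. ?tail k y) \<longlonglongrightarrow> (LINT y|M. 0)"
  proof (rule integral_dominated_convergence[where w = "\<lambda>y. \<bar>\<phi> y\<bar>"])
    have "(\<lambda>k. ?tail k y) \<longlonglongrightarrow> 0" for y
    proof (rule tendsto_eventually)
      obtain k0 where "\<bar>\<phi> y\<bar> \<le> real k0" using real_arch_simple by blast
      then show "\<forall>\<^sub>F k in sequentially. ?tail k y = 0"
        unfolding eventually_sequentially by (intro exI[of _ k0]) auto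
    qed
    then show "AE y in M. (\<lambda>k. ?tail k y) \<longlonglongrightarrow> 0" by simp
  qed (use \<phi> in auto)
  \<comment> \<open>The factor \<open>B\<close> in front of the tail turns this threshold into
    \<open>r / 2\<close>. The level \<open>k\<close> is fixed here, before \<open>N0\<close> is
    chosen depending on it.\<close>
  then have "\<forall>\<^sub>F k in sequentially. (LINT y|M. ?tail k y) < r / (2 * B)"
    by (intro order_tendstoD) (use r B in auto)
  then obtain k where k: "(LINT y|M. ?tail k y) < r / (2 * B)"
    unfolding eventually_sequentially by blast
  have "(\<lambda>N. real k * (LINT y|M. \<bar>g N y\<bar>)) \<longlonglongrightarrow> real k * 0"
    by (intro tendsto_mult_left L1)
  then have "\<forall>\<^sub>F N in sequentially. real k * (LINT y|M. \<bar>g N y\<bar>) < r / 2"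
    by (rule order_tendstoD) (use r in simp)
  then obtain N0 where N0: "\<And>N. N \<ge> N0 \<Longrightarrow> real k * (LINT y|M. \<bar>g N y\<bar>) < r / 2"
    unfolding eventually_sequentially by blast
  have "norm ((LINT y|M. \<phi> y * g N y) - 0) < r" if "N \<ge> N0" for N
  proof -
    have int_g: "integrable M (g N)" by (rule integrable_bounded[of _ B]) (use bnd in auto)
    have le: "\<bar>\<phi> y * g N y\<bar> \<le> real k * \<bar>g N y\<bar> + B * ?tail k y" for y
    proof -
      have "\<bar>\<phi> y * g N y\<bar> \<le> (real k + ?tail k y) * \<bar>g N y\<bar>"
        unfolding abs_mult by (intro mult_right_mono) auto
      also have "\<dots> \<le> real k * \<bar>g N y\<bar> + B * ?tail k y"
        using mult_right_mono[OF bnd[of N y], of "?tail k y"] by (simp add: algebra_simps)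
      finally show ?thesis .
    qed
    have "norm (LINT y|M. \<phi> y * g N y) \<le> (LINT y|M. norm (\<phi> y * g N y))"
      by (rule integral_norm_bound)
    also have "\<dots> \<le> (LINT y|M. real k * \<bar>g N y\<bar> + B * ?tail k y)"
    proof (rule integral_mono)
      show int: "integrable M (\<lambda>y. real k * \<bar>g N y\<bar> + B * ?tail k y)"
        using int_g int_tail by auto
      show "integrable M (\<lambda>y. norm (\<phi> y * g N y))"
        by (rule Bochner_Integration.integrable_bound[OF int])
            (use \<phi> in \<open>auto intro!: AE_I2 order_trans[OF le] abs_ge_self\<close>)
    qed (use le in simp)
    also have "\<dots> = real k * (LINT y|M. \<bar>g N y\<bar>) + B * (LINT y|M. ?tail k y)"
      using int_g int_tail by simp
    also have "\<dots> < r / 2 + B * (r / (2 * B))"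
      using N0[OF that] k B by (intro add_strict_mono mult_strict_left_mono) auto
    also have "\<dots> = r" using B by simp
    finally show ?thesis by simp
  qed
  then show "\<exists>no. \<forall>n\<ge>no. norm ((LINT y|M. \<phi> y * g n y) - 0) < r" by blast
qed

text \<open>Testing the weak-(*) convergence with \<open>b(W\<^sub>m)\<close> and then with the limit \<open>g\<close> itself; the
  measure is finite, so both are integrable.\<close>

lemma corr_limits:
  fixes W :: "nat \<Rightarrow> 'a::euclidean_space \<Rightarrow> 'b::euclidean_space"
  assumes fin: "finite_measure (lebesgue_on Q)"
    and W: "\<forall>n\<ge>1. W n \<in> borel_measurable (lebesgue_on Q)"
    and b: "b \<in> C_c"
    and ws: "weak_star_tendsto Q (\<lambda>N y. cesaro (\<lambda>n. b (W n y)) N) g"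
  shows "m \<ge> 1 \<Longrightarrow> cesaro (\<lambda>n. corr Q W b n m) \<longlonglongrightarrow> (LINT y|lebesgue_on Q. b (W m y) * g y)"
    and "cesaro (\<lambda>m. lim (cesaro (\<lambda>n. corr Q W b n m))) \<longlonglongrightarrow> (LINT y|lebesgue_on Q. g y * g y)"
    and "(1 / (real N)\<^sup>2) * (\<Sum>n=1..N. \<Sum>m=1..N. corr Q W b n m)
      = (LINT y|lebesgue_on Q. (cesaro (\<lambda>n. b (W n y)) N)\<^sup>2)"
proof -
  interpret finite_measure "lebesgue_on Q" by (rule fin)
  obtain B where B: "B > 0" "\<And>x. \<bar>b x\<bar> \<le> B" using C_c_bounded[OF b] by blast
  have bW [measurable]: "(\<lambda>y. b (W n y)) \<in> borel_measurable (lebesgue_on Q)" if "n \<ge> 1" for n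
    using measurable_compose[OF W[rule_format, OF that] C_c_borel_measurable[OF b]] .
  have int_bW: "integrable (lebesgue_on Q) (\<lambda>y. b (W n y))" if "n \<ge> 1" for n
    by (rule integrable_bounded[of _ B]) (use that bW B in auto)
  have int_corr: "integrable (lebesgue_on Q) (\<lambda>y. b (W n y) * b (W m y))" if "n \<ge> 1" "m \<ge> 1" for n m
    by (rule integrable_bounded[of _ "B * B"])
      (use that bW B in \<open>auto simp: abs_mult intro!: mult_mono\<close>)
  obtain C where g: "g \<in> borel_measurable (lebesgue_on Q)" "AE y in lebesgue_on Q. \<bar>g y\<bar> \<le> C"
    using ws by (auto simp: weak_star_tendsto_def L_infty_def)
  have int_g: "integrable (lebesgue_on Q) g"
    by (rule integrable_const_bound[of _ C]) (use g in auto)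
  have int_bWg: "integrable (lebesgue_on Q) (\<lambda>y. b (W m y) * g y)" if "m \<ge> 1" for m
    by (rule Bochner_Integration.integrable_bound[of _ "\<lambda>y. B * g y"])
      (use that int_g g bW B in \<open>auto simp: abs_mult intro!: mult_mono AE_I2\<close>)
  have lims: "(\<lambda>N. LINT y|lebesgue_on Q. \<phi> y * cesaro (\<lambda>n. b (W n y)) N)
      \<longlonglongrightarrow> (LINT y|lebesgue_on Q. \<phi> y * g y)" if "integrable (lebesgue_on Q) \<phi>" for \<phi>
    using ws that by (auto simp: weak_star_tendsto_def)
  show a: "cesaro (\<lambda>n. corr Q W b n m) \<longlonglongrightarrow> (LINT y|lebesgue_on Q. b (W m y) * g y)"
    if m: "m \<ge> 1" for m
  proof -
    have "(LINT y|lebesgue_on Q. b (W m y) * cesaro (\<lambda>n. b (W n y)) N)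
      = cesaro (\<lambda>n. corr Q W b n m) N" for N
    proof -
      have "(LINT y|lebesgue_on Q. b (W m y) * cesaro (\<lambda>n. b (W n y)) N)
        = (LINT y|lebesgue_on Q. (1 / real N) * (\<Sum>n=1..N. b (W n y) * b (W m y)))"
        by (simp add: sum_distrib_left sum_distrib_right mult_ac)
      also have "\<dots> = cesaro (\<lambda>n. corr Q W b n m) N"
        unfolding corr_def integral_mult_right_zero
        by (subst Bochner_Integration.integral_sum) (use int_corr m in auto)
      finally show ?thesis .
    qed
    with lims[OF int_bW[OF m]] show ?thesis by (simp only:)
  qed
  \<comment> \<open>Testing the mean with \<open>g\<close> averages the numbers
    \<open>\<integral> b(W m) g\<close>, and by the first claim these are exactly the inner limits.
    The sum starts at 1, so that claim covers every index.\<close>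
  have "(LINT y|lebesgue_on Q. g y * cesaro (\<lambda>n. b (W n y)) M)
      = cesaro (\<lambda>m. lim (cesaro (\<lambda>n. corr Q W b n m))) M" for M
  proof -
    have "(LINT y|lebesgue_on Q. g y * cesaro (\<lambda>n. b (W n y)) M)
      = (LINT y|lebesgue_on Q. (1 / real M) * (\<Sum>m=1..M. b (W m y) * g y))"
      by (simp add: sum_distrib_left sum_distrib_right mult_ac)
    also have "\<dots> = cesaro (\<lambda>m. LINT y|lebesgue_on Q. b (W m y) * g y) M"
      unfolding integral_mult_right_zero
      by (subst Bochner_Integration.integral_sum) (use int_bWg in auto)
    also have "\<dots> = cesaro (\<lambda>m. lim (cesaro (\<lambda>n. corr Q W b n m))) M"
      using limI[OF a] by (intro arg_cong2[where f = "(*)"] sum.cong) auto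
    finally show ?thesis .
  qed
  with lims[OF int_g]
  show "cesaro (\<lambda>m. lim (cesaro (\<lambda>n. corr Q W b n m))) \<longlonglongrightarrow> (LINT y|lebesgue_on Q. g y * g y)"
    by (simp only:)
  \<comment> \<open>The double sum of products is the square of a single sum; the rest exchanges
    finite sums with the integral.\<close>
  have "(LINT y|lebesgue_on Q. (cesaro (\<lambda>n. b (W n y)) N)\<^sup>2)
    = (LINT y|lebesgue_on Q. (1 / (real N)\<^sup>2) * (\<Sum>n=1..N. \<Sum>m=1..N. b (W n y) * b (W m y)))"
    by (simp add: power_divide power_mult_distrib power2_eq_square sum_product)
  also have "\<dots> = (1 / (real N)\<^sup>2) * (\<Sum>n=1..N. \<Sum>m=1..N. corr Q W b n m)"
    unfolding corr_def integral_mult_right_zero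
    by (subst Bochner_Integration.integral_sum, use int_corr in force)
      (intro arg_cong2[where f = "(*)"] sum.cong refl Bochner_Integration.integral_sum,
        use int_corr in auto)
  finally show "(1 / (real N)\<^sup>2) * (\<Sum>n=1..N. \<Sum>m=1..N. corr Q W b n m)
      = (LINT y|lebesgue_on Q. (cesaro (\<lambda>n. b (W n y)) N)\<^sup>2)" ..
qed

section \<open>Statistical equivalence and L1 distance of the means\<close>

text \<open>By the triangle inequality the L1 distance of the means is at most the Cesaro mean of
  the distances \<open>d n\<close>. These are bounded and exceed any fixed \<open>\<eta> > 0\<close>
  only on a set of indices of density zero, so \<open>cesaro_tendsto_0\<close> applies.\<close>

lemma cesaro_L1_diff_tendsto_0:
  fixes U V :: "nat \<Rightarrow> 'a::euclidean_space \<Rightarrow> 'b::euclidean_space"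
  assumes fin: "finite_measure (lebesgue_on Q)"
    and U: "\<And>n. n \<ge> 1 \<Longrightarrow> U n \<in> borel_measurable (lebesgue_on Q)"
    and V: "\<And>n. n \<ge> 1 \<Longrightarrow> V n \<in> borel_measurable (lebesgue_on Q)"
    and se: "statistically_equivalent Q U V"
    and b: "b \<in> C_c"
  shows "(\<lambda>N. LINT y|lebesgue_on Q. \<bar>cesaro (\<lambda>n. b (V n y)) N - cesaro (\<lambda>n. b (U n y)) N\<bar>) \<longlonglongrightarrow> 0"
proof -
  interpret finite_measure "lebesgue_on Q" by (rule fin)
  let ?M = "lebesgue_on Q" and ?\<mu> = "measure (lebesgue_on Q) (space (lebesgue_on Q))"
  obtain B where B: "B > 0" "\<And>x. \<bar>b x\<bar> \<le> B" using C_c_bounded[OF b] by blast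
  note bm = C_c_borel_measurable[OF b]
  note bU = measurable_compose[OF U bm] and bV = measurable_compose[OF V bm]
  define d where "d n = (LINT y|?M. \<bar>b (U n y) - b (V n y)\<bar>)" for n
  have diff_le: "\<bar>b x - b y\<bar> \<le> 2 * B" for x y using B(2)[of x] B(2)[of y] by linarith
  have int_d: "integrable ?M (\<lambda>y. \<bar>b (U n y) - b (V n y)\<bar>)" if "n \<ge> 1" for n
    by (rule integrable_bounded[of _ "2 * B"]) (use that bU bV diff_le in auto)
  have "cesaro d \<longlonglongrightarrow> 0"
  proof (rule cesaro_tendsto_0[where C = "2 * B * ?\<mu>"])
    show "d n \<le> 2 * B * ?\<mu>" if "n \<ge> 1" for n
    proof -
      have "d n \<le> (LINT y|?M. 2 * B)"
        unfolding d_def by (rule integral_mono) (use int_d that diff_le in auto)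
      then show ?thesis by (simp add: mult.commute)
    qed
    show "d n \<ge> 0" for n by (simp add: d_def)
    show "2 * B * ?\<mu> \<ge> 0" using B by simp
    fix \<eta> :: real assume \<eta>: "\<eta> > 0"
    \<comment> \<open>Chosen so that \<open>\<eta>'\<close> times the mass of \<open>Q\<close> is at
      most \<open>\<eta> / 2\<close>; adding 1 keeps the denominator positive when \<open>Q\<close>
      is a null set.\<close>
    define \<eta>' where "\<eta>' = \<eta> / (2 * (?\<mu> + 1))"
    have \<mu>1: "?\<mu> + 1 > 0" using measure_nonneg[of ?M "space ?M"] by linarith
    have \<eta>': "\<eta>' > 0" using \<eta> \<mu>1 by (simp add: \<eta>'_def)
    obtain K where K: "K > 0" "\<And>x y. \<bar>b x - b y\<bar> \<le> \<eta>' + K * norm (x - y)"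
      using C_c_almost_Lipschitz[OF b \<eta>'] by blast
    \<comment> \<open>Makes \<open>K * \<epsilon>\<close> equal to \<open>\<eta> / 2\<close>, the
      other half of the budget. Hence \<open>d n > \<eta>\<close> forces the integral of
      \<open>norm (U n y - V n y)\<close> above \<open>\<epsilon>\<close>.\<close>
    define \<epsilon> where "\<epsilon> = \<eta> / (2 * K)"
    have \<epsilon>: "\<epsilon> > 0" using \<eta> K by (simp add: \<epsilon>_def)
    have total: "\<eta>' * ?\<mu> + K * \<epsilon> \<le> \<eta>"
    proof -
      have "\<eta>' * ?\<mu> \<le> \<eta>' * (?\<mu> + 1)" using \<eta>' by (intro mult_left_mono) auto
      also have "\<dots> = \<eta> / 2" using \<mu>1 unfolding \<eta>'_def
        by (simp only: times_divide_eq_left) (simp add: field_simps)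
      finally show ?thesis using K by (simp add: \<epsilon>_def)
    qed
    define E where "E N = {n \<in> {1..N}. (\<integral>\<^sup>+ y. ennreal (norm (U n y - V n y)) \<partial>?M) > ennreal \<epsilon>}" for N
    have sub: "{n \<in> {1..N}. d n > \<eta>} \<subseteq> E N" for N
    proof
      fix n assume n: "n \<in> {n \<in> {1..N}. d n > \<eta>}"
      have "(\<integral>\<^sup>+ y. ennreal (norm (U n y - V n y)) \<partial>?M) > ennreal \<epsilon>"
      proof (rule ccontr)
        assume "\<not> ?thesis"
        then have "d n \<le> \<eta>' * ?\<mu> + K * \<epsilon>"
          unfolding d_def using n K B \<epsilon> U V bm by (intro L1_diff_le[where B = B]) auto
        with total n show False by auto
      qed
      with n show "n \<in> E N" by (simp add: E_def)
    qed
    have "(\<lambda>N. real (card (E N)) / real N) \<longlonglongrightarrow> 0"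
      using se \<epsilon> by (simp add: statistically_equivalent_def E_def)
    then show "(\<lambda>N. real (card {n \<in> {1..N}. d n > \<eta>}) / real N) \<longlonglongrightarrow> 0"
    proof (rule Lim_null_comparison[rotated], intro always_eventually allI)
      fix N
      have "card {n \<in> {1..N}. d n > \<eta>} \<le> card (E N)"
        by (intro card_mono sub) (simp add: E_def)
      then show "norm (real (card {n \<in> {1..N}. d n > \<eta>}) / real N) \<le> real (card (E N)) / real N"
        by (simp add: divide_right_mono)
    qed
  qed
  then show ?thesis
  proof (rule Lim_null_comparison[rotated], intro always_eventually allI)
    fix N
    let ?g = "\<lambda>y. cesaro (\<lambda>n. b (V n y)) N - cesaro (\<lambda>n. b (U n y)) N"
    have int: "integrable ?M (\<lambda>y. cesaro (\<lambda>n. \<bar>b (U n y) - b (V n y)\<bar>) N)"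
      by (intro integrable_mult_right Bochner_Integration.integrable_sum int_d) auto
    have le: "\<bar>?g y\<bar> \<le> cesaro (\<lambda>n. \<bar>b (U n y) - b (V n y)\<bar>) N" for y
    proof -
      have "\<bar>?g y\<bar> = (1 / real N) * \<bar>\<Sum>n=1..N. b (U n y) - b (V n y)\<bar>"
        by (simp add: sum_subtractf diff_divide_distrib[symmetric] abs_minus_commute)
      also have "\<dots> \<le> cesaro (\<lambda>n. \<bar>b (U n y) - b (V n y)\<bar>) N"
        by (intro mult_left_mono sum_abs) simp
      finally show ?thesis .
    qed
    have "(LINT y|?M. \<bar>?g y\<bar>) \<le> (LINT y|?M. cesaro (\<lambda>n. \<bar>b (U n y) - b (V n y)\<bar>) N)"
      by (rule integral_mono'[OF int le]) simp
    also have "\<dots> = cesaro d N"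
      unfolding d_def integral_mult_right_zero
      by (subst Bochner_Integration.integral_sum) (use int_d in auto)
    finally show "norm (LINT y|?M. \<bar>?g y\<bar>) \<le> cesaro d N" by simp
  qed
qed

section \<open>Transfer of the (S)-limit\<close>

lemma S_limit_statistically_equivalent:
  fixes U V :: "nat \<Rightarrow> 'a::euclidean_space \<Rightarrow> 'b::euclidean_space"
  assumes fin: "finite_measure (lebesgue_on Q)"
    and U: "\<And>n. n \<ge> 1 \<Longrightarrow> U n \<in> borel_measurable (lebesgue_on Q)"
    and V: "\<And>n. n \<ge> 1 \<Longrightarrow> V n \<in> borel_measurable (lebesgue_on Q)"
    and se: "statistically_equivalent Q U V"
    and S: "S_limit Q U \<V>"
  shows "S_limit Q V \<V>"
proof -
  interpret finite_measure "lebesgue_on Q" by (rule fin)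
  let ?M = "lebesgue_on Q"
  have weak_star: "weak_star_tendsto Q (\<lambda>N y. cesaro (\<lambda>n. b (V n y)) N) g"
    and double: "(\<lambda>N. (LINT y|?M. (cesaro (\<lambda>n. b (V n y)) N)\<^sup>2)
        - (LINT y|?M. (cesaro (\<lambda>n. b (U n y)) N)\<^sup>2)) \<longlonglongrightarrow> 0"
    if b: "b \<in> C_c" and ws: "weak_star_tendsto Q (\<lambda>N y. cesaro (\<lambda>n. b (U n y)) N) g" for b g
  proof -
    obtain B where B: "B > 0" "\<And>x. \<bar>b x\<bar> \<le> B" using C_c_bounded[OF b] by blast
    note bm = C_c_borel_measurable[OF b]
    let ?A = "\<lambda>N y. cesaro (\<lambda>n. b (U n y)) N" and ?B = "\<lambda>N y. cesaro (\<lambda>n. b (V n y)) N"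
    have mA [measurable]: "?A N \<in> borel_measurable ?M" for N
      by (intro borel_measurable_times borel_measurable_sum measurable_compose[OF U bm]) auto
    have mB [measurable]: "?B N \<in> borel_measurable ?M" for N
      by (intro borel_measurable_times borel_measurable_sum measurable_compose[OF V bm]) auto
    have A: "\<bar>?A N y\<bar> \<le> B" for N y by (rule abs_cesaro_le) (use B in auto)
    have B': "\<bar>?B N y\<bar> \<le> B" for N y by (rule abs_cesaro_le) (use B in auto)
    have diff_le: "\<bar>?B N y - ?A N y\<bar> \<le> 2 * B" for N y
      using A[of N y] B'[of N y] by linarith
    note L1 = cesaro_L1_diff_tendsto_0[OF fin U V se b]
    have "(\<lambda>N. LINT y|?M. \<phi> y * ?B N y) \<longlonglongrightarrow> (LINT y|?M. \<phi> y * g y)"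
      if \<phi>: "integrable ?M \<phi>" for \<phi>
    proof -
      have int: "integrable ?M (\<lambda>y. \<phi> y * h y)"
        if "h \<in> borel_measurable ?M" "\<And>y. \<bar>h y\<bar> \<le> B" for h
        by (rule Bochner_Integration.integrable_bound[of _ "\<lambda>y. B * \<phi> y"])
          (use \<phi> that B in \<open>auto simp: abs_mult mult.commute[of B] intro!: mult_left_mono AE_I2\<close>)
      \<comment> \<open>The means differ by at most \<open>2 * B\<close> pointwise, which supplies
        the uniform bound needed to test their L1 convergence with \<open>\<phi>\<close>.\<close>
      have "(\<lambda>N. LINT y|?M. \<phi> y * (?B N y - ?A N y)) \<longlonglongrightarrow> 0"
        using B(1)
        by (intro tendsto_integral_mult_0[OF \<phi> borel_measurable_diff[OF mB mA] diff_le _ L1]) simp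
      moreover have "(\<lambda>N. LINT y|?M. \<phi> y * ?A N y) \<longlonglongrightarrow> (LINT y|?M. \<phi> y * g y)"
        using ws \<phi> by (simp add: weak_star_tendsto_def)
      ultimately have "(\<lambda>N. (LINT y|?M. \<phi> y * (?B N y - ?A N y)) + (LINT y|?M. \<phi> y * ?A N y))
          \<longlonglongrightarrow> 0 + (LINT y|?M. \<phi> y * g y)"
        by (rule tendsto_add)
      moreover have "(LINT y|?M. \<phi> y * (?B N y - ?A N y)) + (LINT y|?M. \<phi> y * ?A N y)
          = (LINT y|?M. \<phi> y * ?B N y)" for N
        unfolding right_diff_distrib
        by (subst Bochner_Integration.integral_diff[OF int[OF mB B'] int[OF mA A]]) simp
      ultimately show ?thesis by simp
    qed
    then show "weak_star_tendsto Q ?B g"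
      using ws mB B' by (auto simp: weak_star_tendsto_def L_infty_def intro!: exI[of _ B] AE_I2)
    \<comment> \<open>The difference of squares factors into the difference and the sum of the
      means, and the sum is bounded by \<open>2 * B\<close>.\<close>
    have "(\<lambda>N. 2 * B * (LINT y|?M. \<bar>?B N y - ?A N y\<bar>)) \<longlonglongrightarrow> 2 * B * 0"
      by (intro tendsto_mult_left L1)
    then show "(\<lambda>N. (LINT y|?M. (?B N y)\<^sup>2) - (LINT y|?M. (?A N y)\<^sup>2)) \<longlonglongrightarrow> 0"
      unfolding mult_zero_right
    proof (rule Lim_null_comparison[rotated], intro always_eventually allI)
      fix N
      have int2: "integrable ?M (\<lambda>y. (h y)\<^sup>2)"
        if "h \<in> borel_measurable ?M" "\<And>y. \<bar>h y\<bar> \<le> B" for h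
        by (rule integrable_bounded[of _ "B\<^sup>2"]) (use that abs_le_square_iff[of _ B] B in auto)
      have "(LINT y|?M. (?B N y)\<^sup>2) - (LINT y|?M. (?A N y)\<^sup>2) = (LINT y|?M. (?B N y)\<^sup>2 - (?A N y)\<^sup>2)"
        by (rule Bochner_Integration.integral_diff[symmetric, OF int2[OF mB B'] int2[OF mA A]])
      also have "norm \<dots> \<le> (LINT y|?M. norm ((?B N y)\<^sup>2 - (?A N y)\<^sup>2))"
        by (rule integral_norm_bound)
      also have "\<dots> \<le> (LINT y|?M. 2 * B * \<bar>?B N y - ?A N y\<bar>)"
      proof (rule integral_mono')
        show "integrable ?M (\<lambda>y. 2 * B * \<bar>?B N y - ?A N y\<bar>)"
          by (intro integrable_mult_right integrable_abs
              integrable_bounded[OF borel_measurable_diff[OF mB mA] diff_le])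
        fix y
        have "\<bar>?B N y + ?A N y\<bar> \<le> 2 * B" using A[of N y] B'[of N y] by linarith
        then show "norm ((?B N y)\<^sup>2 - (?A N y)\<^sup>2) \<le> 2 * B * \<bar>?B N y - ?A N y\<bar>"
          unfolding square_diff_square_factored power2_eq_square real_norm_def abs_mult
          by (rule mult_right_mono) simp
      qed (use B in simp)
      finally show "norm ((LINT y|?M. (?B N y)\<^sup>2) - (LINT y|?M. (?A N y)\<^sup>2))
          \<le> 2 * B * (LINT y|?M. \<bar>?B N y - ?A N y\<bar>)" by simp
    qed
  qed
  have "weakly_S_convergent Q V"
    unfolding weakly_S_convergent_def
  proof (intro ballI conjI allI impI)
    fix b :: "'b \<Rightarrow> real" assume b: "b \<in> C_c"
    obtain g where g: "weak_star_tendsto Q (\<lambda>N y. cesaro (\<lambda>n. b (U n y)) N) g"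
      using S b by (auto simp: S_limit_def)
    have "\<forall>n\<ge>1. U n \<in> borel_measurable ?M" and "\<forall>n\<ge>1. V n \<in> borel_measurable ?M"
      using U V by auto
    note limsU = corr_limits[OF fin this(1) b g]
      and limsV = corr_limits[OF fin this(2) b weak_star[OF b g]]
    show "convergent (cesaro (\<lambda>n. corr Q V b n m))" if "m \<ge> 1" for m
      using limsV(1)[OF that] unfolding convergent_def by blast
    obtain L where L: "(\<lambda>N. (1 / (real N)\<^sup>2) * (\<Sum>n=1..N. \<Sum>m=1..N. corr Q U b n m)) \<longlonglongrightarrow> L"
      "cesaro (\<lambda>m. lim (cesaro (\<lambda>n. corr Q U b n m))) \<longlonglongrightarrow> L"
      using S b unfolding S_limit_def weakly_S_convergent_def by blast
    \<comment> \<open>The double mean of \<open>U\<close> converges to some \<open>L\<close> by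
      assumption; uniqueness of the iterated limit identifies \<open>L\<close> as the integral of
      \<open>g\<close> squared, which is also the iterated limit for \<open>V\<close>.\<close>
    have "L = (LINT y|?M. g y * g y)" by (rule LIMSEQ_unique[OF L(2) limsU(2)])
    moreover have "(\<lambda>N. (1 / (real N)\<^sup>2) * (\<Sum>n=1..N. \<Sum>m=1..N. corr Q V b n m)) \<longlonglongrightarrow> L"
      using tendsto_add[OF double[OF b g] L(1)[unfolded limsU(3)]] unfolding limsV(3) by simp
    ultimately show "\<exists>L. (\<lambda>N. (1 / (real N)\<^sup>2) * (\<Sum>n=1..N. \<Sum>m=1..N. corr Q V b n m)) \<longlonglongrightarrow> L \<and>
        cesaro (\<lambda>m. lim (cesaro (\<lambda>n. corr Q V b n m))) \<longlonglongrightarrow> L"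
      using limsV(2) by blast
  qed
  \<comment> \<open>For each \<open>b\<close> the witness \<open>bU\<close> given for
    \<open>U\<close> is reused for \<open>V\<close>.\<close>
  then show ?thesis
    using S weak_star unfolding S_limit_def by meson
qed

theorem theorem3p2:
  fixes Q :: "(real ^ 'm) set"
    and U V :: "nat \<Rightarrow> real ^ 'm \<Rightarrow> real ^ 'd"
    and \<V> :: "real ^ 'm \<Rightarrow> (real ^ 'd) measure"
  assumes "Q \<in> sets lebesgue" and "emeasure lebesgue Q < \<infinity>"
    and "\<And>n. n \<ge> 1 \<Longrightarrow> U n \<in> borel_measurable (lebesgue_on Q)"
    and "\<And>n. n \<ge> 1 \<Longrightarrow> V n \<in> borel_measurable (lebesgue_on Q)"
    and "statistically_equivalent Q U V"
    and "S_limit Q U \<V>"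
  shows "S_limit Q V \<V>"
proof (rule S_limit_statistically_equivalent[OF _ assms(3,4,5,6)])
  show "finite_measure (lebesgue_on Q)"
    using assms(1,2) by (intro finite_measureI) (simp add: emeasure_restrict_space)
qed

end
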